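(* Let $m\ge1$ and suppose $X\subseteq\mathbb{N}^2$ is periodic modulo $m$, i.e. there is $f:(\mathbb{Z}/m\mathbb{Z})^2\to\{0,1\}$ such that for all distinct $a,b\in\mathbb{N}$, $(a,b)\in X$ iff $f(a\bmod m,\,b\bmod m)=1$. Fix $n\ge1$ and $I\subseteq[n-1]$. For $r\in\mathbb{Z}/m\mathbb{Z}$ let $\ell_r(n)=|\{t\in[n]:t\equiv r\pmod m\}|$. Let $\mathcal{W}_{f,I}(n)$ be the set of words $w=w_1\cdots w_n$ over $\mathbb{Z}/m\mathbb{Z}$ with $|\{i:w_i=r\}|=\ell_r(n)$ for all $r$ and such that for all $i\in[n-1]$, $f(w_i,w_{i+1})=1$ iff $i\in I$. Then \[ d_X(I;n)=|\mathcal{W}_{f,I}(n)|\cdot\prod_{r\in\mathbb{Z}/m\mathbb{Z}}\ell_r(n)!. \]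
   Context: $[n]=\{1,\dots,n\}$. For $\pi=\pi_1\cdots\pi_n\in\mathfrak{S}_n$, $\mathrm{XDes}(\pi)=\{i\in[n-1]:(\pi_i,\pi_{i+1})\in X\}$, and $d_X(I;n)$ is the number of $\pi\in\mathfrak{S}_n$ with $\mathrm{XDes}(\pi)=I$. *)

theory Defs
  imports Complex_Main "HOL-Library.FuncSet" "HOL-Combinatorics.Permutations"
    "HOL-Number_Theory.Cong"
begin

text \<open>
  Residue classes modulo \<open>m\<close> are represented by their canonical representatives \<open>{..<m}\<close>.
  Permutations and words of length \<open>n\<close> are functions on the index set \<open>{1..n}\<close>.
\<close>

definition XDes :: "(nat \<times> nat) set \<Rightarrow> nat \<Rightarrow> (nat \<Rightarrow> nat) \<Rightarrow> nat set" where
  "XDes X n \<pi> = {i \<in> {1..n - 1}. (\<pi> i, \<pi> (i + 1)) \<in> X}"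

definition d :: "(nat \<times> nat) set \<Rightarrow> nat set \<Rightarrow> nat \<Rightarrow> nat" where
  "d X I n = card {\<pi>. \<pi> permutes {1..n} \<and> XDes X n \<pi> = I}"

text \<open>
  Periodicity is required at positive \<open>a\<close>, \<open>b\<close> only, so that the notion covers both conventions
  on whether \<open>0\<close> is a natural number; letters of permutations are always positive.
\<close>

definition periodic_mod_via :: "nat \<Rightarrow> (nat \<times> nat \<Rightarrow> nat) \<Rightarrow> (nat \<times> nat) set \<Rightarrow> bool" where
  "periodic_mod_via m f X \<longleftrightarrow>
     f \<in> {..<m} \<times> {..<m} \<rightarrow> {0, 1} \<and>
     (\<forall>a\<ge>1. \<forall>b\<ge>1. a \<noteq> b \<longrightarrow> ((a, b) \<in> X \<longleftrightarrow> f (a mod m, b mod m) = 1))"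

definition residue_count :: "nat \<Rightarrow> nat \<Rightarrow> nat \<Rightarrow> nat" where
  "residue_count m r n = card {t \<in> {1..n}. [t = r] (mod m)}"

definition residue_words ::
    "nat \<Rightarrow> (nat \<times> nat \<Rightarrow> nat) \<Rightarrow> nat set \<Rightarrow> nat \<Rightarrow> (nat \<Rightarrow> nat) set" where
  "residue_words m f I n =
     {w \<in> {1..n} \<rightarrow>\<^sub>E {..<m}.
        (\<forall>r<m. card {i \<in> {1..n}. w i = r} = residue_count m r n) \<and>
        (\<forall>i\<in>{1..n - 1}. f (w i, w (i + 1)) = 1 \<longleftrightarrow> i \<in> I)}"

end

theory Submission
  imports Defs
begin

text \<open>
  Reducing the letters of a permutation modulo \<open>m\<close> gives a word whose letter counts are those of
  \<open>1, \<dots>, n\<close>. Neighbouring letters of a permutation are distinct, so by periodicity this word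
  determines the \<open>X\<close>-descent set. Conversely, a word with these letter counts is the reduction of
  exactly \<open>\<Prod>r. \<ell>\<^sub>r(n)!\<close> permutations, since the positions carrying the residue \<open>r\<close> are filled
  bijectively by the letters congruent to \<open>r\<close>.
\<close>

text \<open>
  Maps are normalised to be the identity outside \<open>S\<close>, so that for \<open>T = S\<close> these are permutations of
  \<open>S\<close>; distinct \<open>S\<close> and \<open>T\<close> are needed for the induction that removes a point and its image.
\<close>

definition colour_bijections ::
    "('a \<Rightarrow> 'c) \<Rightarrow> ('a \<Rightarrow> 'c) \<Rightarrow> 'a set \<Rightarrow> 'a set \<Rightarrow> ('a \<Rightarrow> 'a) set" where
  "colour_bijections w g S T =
     {p. (\<forall>i. i \<notin> S \<longrightarrow> p i = i) \<and> bij_betw p S T \<and> (\<forall>i\<in>S. g (p i) = w i)}"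

lemma colour_bijections_empty: "colour_bijections w g {} {} = {id}"
  by (auto simp: colour_bijections_def bij_betw_def fun_eq_iff)

lemma colour_bijections_self:
  "colour_bijections w g S S = {p. p permutes S \<and> (\<forall>i\<in>S. g (p i) = w i)}"
  by (auto simp: colour_bijections_def permutes_imp_bij permutes_not_in intro: bij_imp_permutes)

text \<open>Sort the bijections by the image \<open>y\<close> of \<open>x\<close>. Resetting
  \<open>p\<close> at \<open>x\<close> leaves a colour bijection from \<open>S\<close> onto
  \<open>T - {y}\<close>, and updating at \<open>x\<close> undoes this.\<close>

lemma colour_bijections_insert:
  assumes "x \<notin> S"
  shows "colour_bijections w g (insert x S) T =
           (\<Union>y\<in>{y \<in> T. g y = w x}. (\<lambda>p. p(x := y)) ` colour_bijections w g S (T - {y}))"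
    (is "?L = ?R")
proof (intro equalityI subsetI)
  fix p assume p: "p \<in> ?L"
  then have bij: "bij_betw p (insert x S) T" and col: "\<And>i. i \<in> insert x S \<Longrightarrow> g (p i) = w i"
    and out: "\<And>i. i \<notin> insert x S \<Longrightarrow> p i = i"
    by (auto simp: colour_bijections_def)
  have px: "p x \<in> {y \<in> T. g y = w x}"
    using bij col by (auto simp: bij_betw_def)
  have "bij_betw p S (T - {p x})"
    using bij assms by (auto simp: bij_betw_def inj_on_def)
  \<comment> \<open>Once \<open>x\<close> has left the domain, the normalisation demands that it be
    fixed.\<close>
  then have "bij_betw (p(x := x)) S (T - {p x})"
    using assms by (subst bij_betw_cong[where g = p]) auto
  then have "p(x := x) \<in> colour_bijections w g S (T - {p x})"
    using out col assms by (auto simp: colour_bijections_def)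
  moreover have "p = (p(x := x))(x := p x)" by simp
  ultimately show "p \<in> ?R" using px by blast
next
  fix p assume "p \<in> ?R"
  then obtain y q where y: "y \<in> T" "g y = w x" and q: "q \<in> colour_bijections w g S (T - {y})"
    and p: "p = q(x := y)" by auto
  have bij: "bij_betw q S (T - {y})" using q by (simp add: colour_bijections_def)
  have img: "p ` S = T - {y}" using bij p assms by (auto simp: bij_betw_def)
  have "inj_on p S" using bij p assms by (auto simp: bij_betw_def inj_on_def)
  moreover have "p x = y" using p by simp
  ultimately have "bij_betw p (insert x S) T"
    using y img assms by (auto simp: bij_betw_def insert_absorb)
  then show "p \<in> ?L" using q y p by (auto simp: colour_bijections_def)
qed

text \<open>Induction on \<open>S\<close>: with \<open>c\<close> letters of the colour of
  \<open>x\<close>, there are \<open>c\<close> choices for its image, and each leaves the same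
  product with \<open>c!\<close> lowered to \<open>(c - 1)!\<close>. Colours in \<open>R\<close>
  that do not occur contribute \<open>0! = 1\<close>.\<close>

lemma card_colour_bijections:
  fixes w g :: "'a \<Rightarrow> 'c"
  assumes "finite S" and "finite T" and "finite R" and "w ` S \<subseteq> R" and "g ` T \<subseteq> R"
    and "\<And>r. r \<in> R \<Longrightarrow> card {i \<in> S. w i = r} = card {t \<in> T. g t = r}"
  shows "finite (colour_bijections w g S T) \<and>
         card (colour_bijections w g S T) = (\<Prod>r\<in>R. fact (card {t \<in> T. g t = r}))"
  using assms
proof (induction S arbitrary: T rule: finite_induct)
  case empty
  have "T = {}"
  proof (rule ccontr)
    assume "T \<noteq> {}"
    then obtain t where t: "t \<in> T" by blast
    \<comment> \<open>The colour of \<open>t\<close> would have to occur equally often in the empty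
      domain.\<close>
    then have "card {s \<in> T. g s = g t} = 0" using empty.prems(4,5) by fastforce
    then show False using t empty.prems(1) by auto
  qed
  then show ?case by (simp add: colour_bijections_empty)
next
  case (insert x S)
  let ?Y = "{y \<in> T. g y = w x}"
  let ?c = "\<lambda>r. card {t \<in> T. g t = r}"
  let ?B = "\<lambda>y. (\<lambda>p. p(x := y)) ` colour_bijections w g S (T - {y})"
  \<comment> \<open>The number of bijections once the image \<open>y\<close> of \<open>x\<close> is
    fixed. It does not depend on \<open>y\<close>, since removing \<open>y\<close> from
    \<open>T\<close> lowers only the count of the colour \<open>w x\<close>.\<close>
  define N where "N = fact (?c (w x) - 1) * (\<Prod>r\<in>R - {w x}. fact (?c r) :: nat)"
  have finT: "finite T" and wx: "w x \<in> R" using insert.prems by auto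
  have cS: "card {i \<in> insert x S. w i = r} = card {i \<in> S. w i = r} + (if r = w x then 1 else 0)" for r
  proof -
    have "{i \<in> insert x S. w i = r} =
          (if r = w x then insert x {i \<in> S. w i = r} else {i \<in> S. w i = r})" by auto
    then show ?thesis using insert.hyps by simp
  qed
  have B: "finite (?B y) \<and> card (?B y) = N" if y: "y \<in> ?Y" for y
  proof -
    have cT: "card {t \<in> T - {y}. g t = r} = ?c r - (if r = w x then 1 else 0)" for r
    proof -
      have "{t \<in> T - {y}. g t = r} = {t \<in> T. g t = r} - (if r = w x then {y} else {})"
        using y by auto
      then show ?thesis using y by simp
    qed
    have IH: "finite (colour_bijections w g S (T - {y})) \<and>
          card (colour_bijections w g S (T - {y})) = (\<Prod>r\<in>R. fact (card {t \<in> T - {y}. g t = r}))"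
    proof (rule insert.IH)
      fix r assume "r \<in> R"
      then show "card {i \<in> S. w i = r} = card {t \<in> T - {y}. g t = r}"
        using insert.prems(5)[of r] cS[of r] cT[of r] by (simp split: if_splits)
    qed (use insert.prems in auto)
    have "(\<Prod>r\<in>R. fact (card {t \<in> T - {y}. g t = r})) = N"
      unfolding N_def prod.remove[OF insert.prems(2) wx] cT by (auto intro: prod.cong)
    moreover have "inj_on (\<lambda>p. p(x := y)) (colour_bijections w g S (T - {y}))"
    proof (rule inj_onI)
      fix p q assume "p \<in> colour_bijections w g S (T - {y})" "q \<in> colour_bijections w g S (T - {y})"
        and eq: "p(x := y) = q(x := y)"
      \<comment> \<open>Both maps fix \<open>x\<close>, which lies outside \<open>S\<close>, so
        overwriting the value there loses nothing.\<close>
      then have "p x = q x" using insert.hyps by (simp add: colour_bijections_def)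
      then show "p = q" using eq by (metis fun_upd_triv fun_upd_upd)
    qed
    ultimately show ?thesis using IH by (simp add: card_image)
  qed
  have disj: "?B y \<inter> ?B z = {}" if "y \<noteq> z" for y z
    using that by (auto dest: fun_cong[of _ _ x])
  have "card (colour_bijections w g (insert x S) T) = (\<Sum>y\<in>?Y. card (?B y))"
    unfolding colour_bijections_insert[OF insert.hyps(2)]
    using B disj finT by (intro card_UN_disjoint) auto
  also have "\<dots> = ?c (w x) * N" using B by simp
  also have "\<dots> = (\<Prod>r\<in>R. fact (?c r))"
  proof -
    \<comment> \<open>The point \<open>x\<close> itself has colour \<open>w x\<close>. Positivity
      makes \<open>c * (c - 1)! = c!\<close> valid under truncated subtraction.\<close>
    have "?c (w x) > 0" using insert.prems(5)[OF wx] cS[of "w x"] by simp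
    then show ?thesis
      unfolding N_def prod.remove[OF insert.prems(2) wx] by (simp add: fact_reduce)
  qed
  finally show ?case
    using B finT by (simp add: colour_bijections_insert[OF insert.hyps(2)])
qed

lemma card_permutes_colour:
  assumes "finite S" and "finite R" and "w ` S \<subseteq> R" and "g ` S \<subseteq> R"
    and "\<And>r. r \<in> R \<Longrightarrow> card {i \<in> S. w i = r} = card {t \<in> S. g t = r}"
  shows "card {p. p permutes S \<and> (\<forall>i\<in>S. g (p i) = w i)} =
         (\<Prod>r\<in>R. fact (card {t \<in> S. g t = r}))"
  using card_colour_bijections[OF assms(1,1,2-5)] by (simp add: colour_bijections_self)

lemma residue_count_eq_card_mod:
  "r < m \<Longrightarrow> residue_count m r n = card {t \<in> {1..n}. t mod m = r}"
  by (simp add: residue_count_def cong_def)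

text \<open>\<open>p\<close> maps the first set bijectively onto the second. With \<open>P\<close> a
  residue condition, this gives the letter counts of a reduced permutation.\<close>

lemma card_permutes_preimage:
  assumes "p permutes S"
  shows "card {i \<in> S. P (p i)} = card {t \<in> S. P t}"
proof -
  have "p ` {i \<in> S. P (p i)} = {t \<in> S. P t}"
  proof (intro equalityI subsetI)
    fix t assume t: "t \<in> {t \<in> S. P t}"
    then obtain i where "i \<in> S" "t = p i" using permutes_image[OF assms] by blast
    then show "t \<in> p ` {i \<in> S. P (p i)}" using t by blast
  qed (use permutes_in_image[OF assms] in auto)
  then show ?thesis
    by (metis (no_types, lifting) card_image inj_on_subset permutes_inj[OF assms] subset_UNIV)
qed

text \<open>Periodicity speaks only of distinct positive arguments; neighbouring letters are
  distinct by injectivity and positive because they lie in \<open>{1..n}\<close>.\<close>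

lemma mem_XDes_periodic:
  assumes "periodic_mod_via m f X" and "p permutes {1..n}" and "i \<in> {1..n - 1}"
  shows "i \<in> XDes X n p \<longleftrightarrow> f (p i mod m, p (i + 1) mod m) = 1"
proof -
  have "i \<in> {1..n}" "i + 1 \<in> {1..n}" using assms(3) by auto
  then have "p i \<ge> 1" "p (i + 1) \<ge> 1"
    using permutes_in_image[OF assms(2)] by (metis atLeastAtMost_iff)+
  moreover have "p i \<noteq> p (i + 1)"
    using permutes_inj[OF assms(2)] by (simp add: inj_eq)
  ultimately show ?thesis
    using assms(1,3) by (simp add: XDes_def periodic_mod_via_def)
qed

lemma permutes_XDes_eq_Union_residue_words:
  assumes "m \<ge> 1" and "periodic_mod_via m f X" and "I \<subseteq> {1..n - 1}"
  shows "{p. p permutes {1..n} \<and> XDes X n p = I} =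
         (\<Union>w\<in>residue_words m f I n. {p. p permutes {1..n} \<and> (\<forall>i\<in>{1..n}. p i mod m = w i)})"
    (is "?L = ?R")
proof (intro equalityI subsetI)
  fix p assume "p \<in> ?L"
  then have p: "p permutes {1..n}" and des: "XDes X n p = I" by auto
  \<comment> \<open>Words are extensional functions, so the reduction is cut off outside
    \<open>{1..n}\<close>.\<close>
  define w where "w = restrict (\<lambda>i. p i mod m) {1..n}"
  have w: "w i = p i mod m" if "i \<in> {1..n}" for i using that by (simp add: w_def)
  have "w \<in> {1..n} \<rightarrow>\<^sub>E {..<m}" using assms(1) by (auto simp: w_def)
  moreover have "card {i \<in> {1..n}. w i = r} = residue_count m r n" if "r < m" for r
  proof -
    have "{i \<in> {1..n}. w i = r} = {i \<in> {1..n}. p i mod m = r}" using w by auto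
    then show ?thesis
      using card_permutes_preimage[OF p, of "\<lambda>t. t mod m = r"] that
      by (simp add: residue_count_eq_card_mod)
  qed
  moreover have "f (w i, w (i + 1)) = 1 \<longleftrightarrow> i \<in> I" if "i \<in> {1..n - 1}" for i
  proof -
    have "i \<in> {1..n}" "i + 1 \<in> {1..n}" using that by auto
    then show ?thesis using mem_XDes_periodic[OF assms(2) p that] des w by simp
  qed
  ultimately have "w \<in> residue_words m f I n" by (simp add: residue_words_def)
  moreover have "p \<in> {p. p permutes {1..n} \<and> (\<forall>i\<in>{1..n}. p i mod m = w i)}"
    using p w by simp
  ultimately show "p \<in> ?R" by blast
next
  fix p assume "p \<in> ?R"
  then obtain w where w: "w \<in> residue_words m f I n" and p: "p permutes {1..n}"
    and pw: "\<And>i. i \<in> {1..n} \<Longrightarrow> p i mod m = w i" by auto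
  have "i \<in> XDes X n p \<longleftrightarrow> i \<in> I" if "i \<in> {1..n - 1}" for i
  proof -
    have "i \<in> {1..n}" "i + 1 \<in> {1..n}" using that by auto
    then show ?thesis
      using mem_XDes_periodic[OF assms(2) p that] pw w that by (simp add: residue_words_def)
  qed
  \<comment> \<open>Both \<open>XDes X n p\<close> and \<open>I\<close> lie in this range, so
    agreement on it gives equality.\<close>
  moreover have "XDes X n p \<subseteq> {1..n - 1}" by (auto simp: XDes_def)
  ultimately show "p \<in> ?L" using assms(3) p by blast
qed

theorem theorem2p5:
  fixes m n :: nat and X :: "(nat \<times> nat) set" and f :: "nat \<times> nat \<Rightarrow> nat" and I :: "nat set"
  assumes "m \<ge> 1" and "periodic_mod_via m f X" and "n \<ge> 1" and "I \<subseteq> {1..n - 1}"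
  shows "d X I n = card (residue_words m f I n) * (\<Prod>r<m. fact (residue_count m r n))"
proof -
  let ?W = "residue_words m f I n"
  let ?F = "\<lambda>w. {p. p permutes {1..n} \<and> (\<forall>i\<in>{1..n}. p i mod m = w i)}"
  have "finite ({1..n} \<rightarrow>\<^sub>E {..<m})" by (intro finite_PiE) auto
  then have "finite ?W" by (rule rev_finite_subset) (auto simp: residue_words_def)
  moreover have "finite (?F w)" for w
    by (rule finite_subset[OF _ finite_permutations[of "{1..n}"]]) auto
  \<comment> \<open>Distinct extensional words differ at some position in \<open>{1..n}\<close>,
    where no permutation can reduce to both.\<close>
  moreover have "?F v \<inter> ?F w = {}" if "v \<in> ?W" "w \<in> ?W" "v \<noteq> w" for v w
  proof -
    have "v \<in> {1..n} \<rightarrow>\<^sub>E {..<m}" "w \<in> {1..n} \<rightarrow>\<^sub>E {..<m}"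
      using that by (auto simp: residue_words_def)
    then obtain i where "i \<in> {1..n}" "v i \<noteq> w i" using \<open>v \<noteq> w\<close> by (meson PiE_ext)
    then show ?thesis by force
  qed
  ultimately have "card (\<Union>w\<in>?W. ?F w) = (\<Sum>w\<in>?W. card (?F w))"
    by (intro card_UN_disjoint) auto
  moreover have "card (?F w) = (\<Prod>r<m. fact (residue_count m r n))" if w: "w \<in> ?W" for w
  proof -
    have "card (?F w) = (\<Prod>r<m. fact (card {t \<in> {1..n}. t mod m = r}))"
    \<comment> \<open>The colours are the residues \<open>{..<m}\<close>, and a letter is coloured
      by its value mod \<open>m\<close>.\<close>
    proof (rule card_permutes_colour)
      show "w ` {1..n} \<subseteq> {..<m}" using w by (auto simp: residue_words_def)
      show "card {i \<in> {1..n}. w i = r} = card {t \<in> {1..n}. t mod m = r}" if "r \<in> {..<m}" for r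
        using w that by (simp add: residue_words_def residue_count_eq_card_mod)
    qed (use assms(1) in auto)
    then show ?thesis by (simp add: residue_count_eq_card_mod)
  qed
  ultimately show ?thesis
    unfolding d_def permutes_XDes_eq_Union_residue_words[OF assms(1,2,4)] by simp
qed

end
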